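(* Let $W=\{\mathfrak{U}_k\}_{k=1}^\infty$ be a countably infinite minimal collection of (pairwise different) free ultrafilters on $\mathbb{N}$, and let $\mathfrak{F}=\cap W$. Then there exists a free ultrafilter $\mathfrak{U}_0$ on $\mathbb{N}$ such that $\mathfrak{U}_0\supset\mathfrak{F}$ but $\mathfrak{U}_0\notin W$. In particular, the representation of $\mathfrak{F}$ as a countable intersection of ultrafilters is not unique: $\mathfrak{F}=\bigcap_{k=1}^\infty\mathfrak{U}_k$ and at the same time $\mathfrak{F}=\bigcap_{k=0}^\infty\mathfrak{U}_k$.
   Context: Filters on $\mathbb{N}$ are proper; a filter is free if it contains every subset of $\mathbb{N}$ with finite complement; an ultrafilter is a maximal filter. For a collection $W$ of filters, $\cap W=\{B\subset\mathbb{N} : B\in\mathfrak{U}\ \text{for all}\ \mathfrak{U}\in W\}$. A collection $W$ of free ultrafilters consisting of at least two elements is minimal if $\cap W\neq\cap(W\setminus\{\mathfrak{U}\})$ for every $\mathfrak{U}\in W$. *)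

theory Defs
  imports Main
begin

text \<open>
  A set \<open>B\<close> belongs to the filter \<open>F\<close> when \<open>eventually (\<lambda>n. n \<in> B) F\<close> holds. The library's
  filter type also contains the improper filter \<open>bot\<close>, so properness is written \<open>F \<noteq> bot\<close>.
  The library order is the reverse of inclusion of collections of sets: \<open>F \<le> G\<close> means that
  every member of \<open>G\<close> is a member of \<open>F\<close>. Hence the intersection of a collection \<open>W\<close> of
  filters is \<open>Sup W\<close> (see \<open>eventually_Sup\<close>).
\<close>

definition free_filter :: "nat filter \<Rightarrow> bool" where
  "free_filter F \<longleftrightarrow> F \<noteq> bot \<and> (\<forall>B. finite (- B) \<longrightarrow> eventually (\<lambda>n. n \<in> B) F)"

text \<open>Maximality with respect to inclusion is minimality in the library order.\<close>

definition ultrafilter :: "nat filter \<Rightarrow> bool" where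
  "ultrafilter F \<longleftrightarrow> F \<noteq> bot \<and> (\<forall>G. G \<noteq> bot \<and> G \<le> F \<longrightarrow> G = F)"

definition free_ultrafilter :: "nat filter \<Rightarrow> bool" where
  "free_ultrafilter F \<longleftrightarrow> free_filter F \<and> ultrafilter F"

definition minimal_collection :: "nat filter set \<Rightarrow> bool" where
  "minimal_collection W \<longleftrightarrow>
     (\<forall>U\<in>W. free_ultrafilter U) \<and>
     (\<exists>U\<in>W. \<exists>V\<in>W. U \<noteq> V) \<and>
     (\<forall>U\<in>W. Sup W \<noteq> Sup (W - {U}))"

end

theory Submission
  imports Defs
begin

text \<open>
  The new ultrafilter arises as a limit of \<open>W\<close> along which every single member of \<open>W\<close> is
  eventually discarded. Since \<open>W\<close> is infinite, removing finitely many members leaves a nonempty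
  subcollection, so the intersections of the collections \<open>W - S\<close>, with \<open>S \<subseteq> W\<close> finite, form an
  upward directed family of proper filters, and together they generate a proper filter
  (\<open>cofinite_limit_proper\<close>). Zorn's lemma extends it to an ultrafilter \<open>U\<^sub>0\<close>
  (\<open>ultrafilter_refining\<close>).

  For each \<open>V \<in> W\<close> the ultrafilter \<open>U\<^sub>0\<close> contains the intersection of \<open>W - {V}\<close>. Minimality says
  precisely that \<open>V\<close> itself does not (\<open>not_le_Sup_others\<close>): otherwise removing \<open>V\<close> would not
  change the intersection. Hence \<open>U\<^sub>0 \<noteq> V\<close> for every \<open>V \<in> W\<close>, whereas \<open>U\<^sub>0\<close> contains the
  intersection of \<open>W\<close>, which makes it free and lets it be added to \<open>W\<close> without changing that
  intersection.
\<close>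

text \<open>
  A chain of proper filters has a proper union, because an improper union would have the empty
  set in one of its members; so Zorn's lemma applies, with the library order reversed.
\<close>

lemma ultrafilter_refining:
  assumes "F \<noteq> bot"
  obtains U where "ultrafilter U" and "U \<le> F"
proof -
  let ?A = "{G. G \<noteq> bot \<and> G \<le> F}"
  have "\<exists>m\<in>?A. \<forall>a\<in>?A. a \<le> m \<longrightarrow> a = m"
  proof (rule predicate_Zorn)
    show "partial_order_on ?A (relation_of (\<lambda>x y. y \<le> x) ?A)"
      by (rule partial_order_on_relation_ofI) auto
  next
    fix C assume "C \<in> Chains (relation_of (\<lambda>x y. y \<le> x) ?A)"
    then have sub: "C \<subseteq> ?A" and chain: "\<And>a b. a \<in> C \<Longrightarrow> b \<in> C \<Longrightarrow> a \<le> b \<or> b \<le> a"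
      by (auto simp: Chains_def relation_of_def)
    show "\<exists>u\<in>?A. \<forall>a\<in>C. u \<le> a"
    proof (cases "C = {}")
      case True
      then show ?thesis using assms by auto
    next
      case False
      have "\<exists>k\<in>C. k \<le> inf i j" if "i \<in> C" "j \<in> C" for i j
        using chain[OF that] that by auto
      then have "(INF G\<in>C. G) = bot \<longleftrightarrow> (\<exists>G\<in>C. G = bot)"
        by (rule INF_filter_bot_base)
      then have "Inf C \<noteq> bot"
        using sub by auto
      moreover have "Inf C \<le> F"
        using False sub by (auto intro: Inf_lower2)
      ultimately show ?thesis
        by (auto intro: Inf_lower)
    qed
  qed
  then obtain m where "m \<noteq> bot" "m \<le> F" and min: "\<forall>a\<in>?A. a \<le> m \<longrightarrow> a = m"
    by blast
  then have "ultrafilter m"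
    unfolding ultrafilter_def using order_trans[OF _ \<open>m \<le> F\<close>] by blast
  then show thesis
    using \<open>m \<le> F\<close> by (rule that)
qed

text \<open>
  The filter in question consists of the sets that belong to all but finitely many members
  of \<open>W\<close>; the empty set belongs to none of them.
\<close>

lemma cofinite_limit_proper:
  fixes W :: "'a filter set"
  assumes "infinite W" and proper: "\<And>V. V \<in> W \<Longrightarrow> V \<noteq> bot"
  shows "(INF S\<in>{S. S \<subseteq> W \<and> finite S}. Sup (W - S)) \<noteq> bot"
proof -
  let ?I = "{S. S \<subseteq> W \<and> finite S}"
  have "\<exists>k\<in>?I. Sup (W - k) \<le> inf (Sup (W - i)) (Sup (W - j))" if "i \<in> ?I" "j \<in> ?I" for i j
    using that by (intro bexI[of _ "i \<union> j"]) (auto intro!: Sup_subset_mono)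
  then have "(INF S\<in>?I. Sup (W - S)) = bot \<longleftrightarrow> (\<exists>S\<in>?I. Sup (W - S) = bot)"
    by (rule INF_filter_bot_base)
  moreover have "Sup (W - S) \<noteq> bot" if "S \<in> ?I" for S
  proof -
    have "infinite (W - S)"
      using that assms(1) by auto
    then obtain V where "V \<in> W - S"
      using infinite_imp_nonempty by blast
    then show ?thesis
      using proper by auto
  qed
  ultimately show ?thesis
    by blast
qed

lemma not_le_Sup_others:
  fixes V :: "'a::complete_lattice"
  assumes "V \<in> W" and "Sup W \<noteq> Sup (W - {V})"
  shows "\<not> V \<le> Sup (W - {V})"
proof
  assume "V \<le> Sup (W - {V})"
  moreover have "Sup W = sup V (Sup (W - {V}))"
    using \<open>V \<in> W\<close> by (metis Sup_insert insert_Diff)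
  ultimately show False
    using assms(2) by (simp add: sup_absorb2)
qed

lemma exists_ultrafilter_outside:
  assumes "infinite W" and proper: "\<And>V. V \<in> W \<Longrightarrow> V \<noteq> bot"
    and min: "\<And>V. V \<in> W \<Longrightarrow> Sup W \<noteq> Sup (W - {V})"
  obtains U0 where "ultrafilter U0" and "U0 \<le> Sup W" and "U0 \<notin> W"
proof -
  obtain U0 where U0: "ultrafilter U0"
    and le: "U0 \<le> (INF S\<in>{S. S \<subseteq> W \<and> finite S}. Sup (W - S))"
    using cofinite_limit_proper[OF assms(1,2)] by (rule ultrafilter_refining)
  have le': "U0 \<le> Sup (W - S)" if "S \<subseteq> W" "finite S" for S
    using le by (rule order_trans) (use that in \<open>auto intro: INF_lower\<close>)
  have "U0 \<noteq> V" if "V \<in> W" for V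
    using le'[of "{V}"] not_le_Sup_others[OF that min[OF that]] that by auto
  then show thesis
    using that[OF U0] le'[of "{}"] by auto
qed

lemma free_filter_le_Sup:
  assumes "\<And>V. V \<in> W \<Longrightarrow> free_filter V" and "G \<noteq> bot" and "G \<le> Sup W"
  shows "free_filter G"
  using assms unfolding free_filter_def by (metis eventually_Sup filter_leD)

theorem theorem3p16:
  fixes U :: "nat \<Rightarrow> nat filter" and W :: "nat filter set" and F :: "nat filter"
  assumes "inj_on U {1..}"
    and "W = U ` {1..}"
    and "minimal_collection W"
    and "F = Sup W"
  shows "\<exists>U0. free_ultrafilter U0 \<and> U0 \<le> F \<and> U0 \<notin> W \<and>
           F = (SUP k\<in>{1..}. U k) \<and>
           F = (SUP k\<in>{0..}. (U(0 := U0)) k)"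
proof -
  have free: "free_filter V" if "V \<in> W" for V
    using assms(3) that by (auto simp: minimal_collection_def free_ultrafilter_def)
  then have proper: "V \<noteq> bot" if "V \<in> W" for V
    using that by (auto simp: free_filter_def)
  have min: "Sup W \<noteq> Sup (W - {V})" if "V \<in> W" for V
    using assms(3) that by (auto simp: minimal_collection_def)
  have "infinite W"
    using assms(1,2) finite_imageD infinite_Ici by blast
  then obtain U0 where U0: "ultrafilter U0" "U0 \<le> Sup W" "U0 \<notin> W"
    using exists_ultrafilter_outside proper min by metis
  then have "free_ultrafilter U0"
    using free_filter_le_Sup[OF free] by (auto simp: free_ultrafilter_def ultrafilter_def)
  moreover have "F = (SUP k\<in>{0..}. (U(0 := U0)) k)"
  proof -
    have "{0..} = insert 0 {1::nat..}"
      by auto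
    then have "(U(0 := U0)) ` {0..} = insert U0 W"
      using assms(2) by auto
    then show ?thesis
      using U0(2) assms(4) by (simp add: sup_absorb2)
  qed
  ultimately show ?thesis
    using U0 assms(2,4) by auto
qed

end
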